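(* Let $(X,\mathcal{F})$ be either a compact foliated space (with $\mathcal{F}$ its set of leaves) or a topological space $X$ equipped with the set $\mathcal{F}$ of orbits of a continuous group action. Then: (1) The Morse hyper-graph $\mathcal{G}_{\mathcal{F}}$ of $\mathcal{F}$ exists, i.e. $X\setminus\bigsqcup_{\lambda\in\Lambda}M_\lambda=\bigsqcup_{I\subseteq\Lambda}H_I$. (2) The Morse hyper-graph $\mathcal{G}_{\mathcal{F}}$ is a quotient space of the abstract element space $X/\langle\mathcal{F}\rangle$ and of the abstract weak element space $X/[\mathcal{F}]$; that is, every abstract element and every abstract weak element is contained in a single member of the decomposition of $X$ consisting of the vertices $M_\lambda$ and the non-empty hyper-edges $H_I$.
   Context: Foliated spaces. Fix $r\in\mathbb{Z}_{\ge0}\sqcup\{\infty\}$ and $n\in\mathbb{Z}_{\ge0}$. For topological spaces $Z,Z'$ and $U\subseteq\mathbb{R}^n\times Z$ open with coordinates $(x,z)$, a map $f\colon U\to\mathbb{R}^n$ is $C^r$ if its partial derivatives up to order $r$ with respect to $x$ exist and are continuous on $U$; a map $U\to\mathbb{R}^n\times Z'$ of the form $(x,z)\mapsto(h_1(x,z),h_2(z))$ is $C^r$ if $h_1$ is $C^r$ and $h_2$ is continuous. A $C^r$ foliated atlas of dimension $n$ on $X$ is a collection $\{(U_i,\phi_i)\}$ where the $U_i$ form an open cover of $X$, each $\phi_i\colon U_i\to B_i\times Z_i$ is a homeomorphism with $B_i\subseteq\mathbb{R}^n$ an open ball and $Z_i$ a locally compact separable completely metrizable space, and the coordinate changes $\phi_j\circ\phi_i^{-1}$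 are locally $C^r$ maps of the form $(x,z)\mapsto(g_{ij}(x,z),h_{ij}(z))$. The sets $\phi_i^{-1}(B_i\times\{z\})$ are plaques; the open subsets of plaques of all charts form a base of a locally Euclidean topology on $X$, whose connected components are the leaves. A foliated space is a space $X$ with a maximal $C^r$ foliated atlas; $\mathcal{F}$ denotes its set of leaves. Decompositions. A decomposition $\mathcal{F}$ of a topological space $X$ is a family of pairwise disjoint non-empty subsets with union $X$; $\mathcal{F}(x)$ is the element containing $x$ and $q\colon X\to X/\mathcal{F}$ is the quotient map (quotient topology). The class decomposition $\hat{\mathcal{F}}$ consists of the sets $\hat{L}=\{x\in X\mid\overline{\mathcal{F}(x)}=\overline{L}\}$, $L\in\mathcal{F}$; a set is $\hat{\mathcal{F}}$-invariant if it is a union of elements of $\hat{\mathcal{F}}$. An element $L$ is closed if $\overline{L}=L$, and proper if $\overline{L}\setminus L$ is closed; $\mathrm{Cl}(\mathcal{F})$, $\mathrm{P}(\mathcal{F})$, $\mathrm{R}(\mathcal{F})$ are the unions of the closed, non-closed proper, and non-proper elements, and $\mathcal{R}(\mathcal{F})=\mathrm{Cl}(\mathcal{F})\sqcup\mathrm{R}(\mathcal{F})$. The abstract element $\langle L\rangle$ of $L\in\mathcal{F}$ is the inverse image under $q$ of the connected component containing $L$ of $\{L'\in X/\mathcal{F}\mid\overline{L}\setminus L=\overline{L'}\setminus L'\}$ if $L\subseteq\mathrm{Cl}(\mathcal{F})\sqcup\mathrm{P}(\mathcal{F})$, and of $\{L'\in X/\mathcal{F}\mid\overline{L}=\overline{L'}\}$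 if $L\subseteq\mathrm{R}(\mathcal{F})$. The abstract weak element $[L]$ is defined in the same way but with the additional requirement that $L'$ be homeomorphic to $L$ in both sets. For $x\in X$ put $\langle x\rangle=\langle\mathcal{F}(x)\rangle$ and $[x]=[\mathcal{F}(x)]$. $X/\langle\mathcal{F}\rangle$ (resp. $X/[\mathcal{F}]$) is the quotient space of $X$ identifying $x,y$ when $\langle x\rangle=\langle y\rangle$ (resp. $[x]=[y]$). A point $x$ is non-maximal if there is $y\in X$ with $\overline{\mathcal{F}(x)}\subsetneq\overline{\mathcal{F}(y)}$. A point $x$ is quasi-recurrent if $\langle x\rangle$ contains a point of $\mathcal{R}(\mathcal{F})$ or a non-maximal point; $\mathcal{Q}(\mathcal{F})$ is the set of quasi-recurrent points. Morse hyper-graph. Let $\mathcal{M}=\{M_\lambda\}_{\lambda\in\Lambda}$ be the set of inverse images under $q$ of the connected components of $q(\mathcal{Q}(\mathcal{F}))\subseteq X/\mathcal{F}$ (required to be disjoint $\hat{\mathcal{F}}$-invariant non-empty sets). For $I\subseteq\Lambda$, the hyper-edge $H_I$ is the set of $x\in X\setminus\bigsqcup_\lambda M_\lambda$ for which there are disjoint $\hat{\mathcal{F}}$-invariant non-empty subsets $(C_i)_{i\in I}$ of $\overline{\mathcal{F}(x)}\setminus\mathcal{F}(x)$ with $C_i\subseteq M_i$ and $\overline{\mathcal{F}(x)}\setminus\mathcal{F}(x)=\bigsqcup_{i\in I}C_i$. The Morse hyper-graph $\mathcal{G}_{\mathcal{F}}=(V,H)$, $V=\{M_\lambda\mid\lambda\in\Lambda\}$,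 $H=\{\{M_i\}_{i\in I}\mid H_I\ne\emptyset,\ I\subseteq\Lambda\}$, exists if $X\setminus\bigsqcup_\lambda M_\lambda=\bigsqcup_{I\subseteq\Lambda}H_I$. As a space it is regarded as the quotient of $X$ whose points are the sets $M_\lambda$ and the non-empty sets $H_I$. *)

theory Defs
  imports "HOL-Analysis.Analysis" "HOL-Algebra.Group_Action"
    "HOL-Library.Disjoint_Sets" "HOL-Library.Extended_Nat"
begin

section \<open>Quotient spaces\<close>

text \<open>The quotient of \<open>X\<close> identifying points with the same value under \<open>f\<close>; its points are
  the values of \<open>f\<close>.\<close>

definition quotient_topology :: "'a topology \<Rightarrow> ('a \<Rightarrow> 'b) \<Rightarrow> 'b topology" where
  "quotient_topology X f =
     topology (\<lambda>V. V \<subseteq> f ` topspace X \<and> openin X {x \<in> topspace X. f x \<in> V})"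

lemma istopology_quotient_topology:
  "istopology (\<lambda>V. V \<subseteq> f ` topspace X \<and> openin X {x \<in> topspace X. f x \<in> V})"
  unfolding istopology_def
proof (intro conjI allI impI)
  fix S T
  assume S: "S \<subseteq> f ` topspace X \<and> openin X {x \<in> topspace X. f x \<in> S}"
    and T: "T \<subseteq> f ` topspace X \<and> openin X {x \<in> topspace X. f x \<in> T}"
  show "S \<inter> T \<subseteq> f ` topspace X" using S by auto
  have "{x \<in> topspace X. f x \<in> S \<inter> T} =
      {x \<in> topspace X. f x \<in> S} \<inter> {x \<in> topspace X. f x \<in> T}" by auto
  with S T show "openin X {x \<in> topspace X. f x \<in> S \<inter> T}" by (simp add: openin_Int)
next
  fix K
  assume K: "\<forall>V\<in>K. V \<subseteq> f ` topspace X \<and> openin X {x \<in> topspace X. f x \<in> V}"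
  show "\<Union>K \<subseteq> f ` topspace X" using K by auto
  have "{x \<in> topspace X. f x \<in> \<Union>K} = \<Union>((\<lambda>V. {x \<in> topspace X. f x \<in> V}) ` K)" by auto
  moreover have "openin X (\<Union>((\<lambda>V. {x \<in> topspace X. f x \<in> V}) ` K))"
    by (rule openin_Union) (use K in auto)
  ultimately show "openin X {x \<in> topspace X. f x \<in> \<Union>K}" by simp
qed

lemma openin_quotient_topology:
  "openin (quotient_topology X f) V \<longleftrightarrow>
     V \<subseteq> f ` topspace X \<and> openin X {x \<in> topspace X. f x \<in> V}"
  unfolding quotient_topology_def topology_inverse'[OF istopology_quotient_topology] ..

lemma topspace_quotient_topology [simp]: "topspace (quotient_topology X f) = f ` topspace X"
proof
  show "topspace (quotient_topology X f) \<subseteq> f ` topspace X"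
    using openin_quotient_topology[of X f "topspace (quotient_topology X f)"] by simp
  have "{x \<in> topspace X. f x \<in> f ` topspace X} = topspace X" by auto
  then have "openin (quotient_topology X f) (f ` topspace X)"
    by (simp add: openin_quotient_topology)
  then show "f ` topspace X \<subseteq> topspace (quotient_topology X f)"
    by (rule openin_subset)
qed

lemma quotient_map_quotient_topology: "quotient_map X (quotient_topology X f) f"
  by (auto simp: quotient_map_def openin_quotient_topology)


section \<open>Foliated spaces\<close>

text \<open>\<open>\<real>\<^sup>n\<close> is the library's \<open>Euclidean_space n\<close> (functions vanishing from index \<open>n\<close> on), which
  includes \<open>n = 0\<close>.\<close>

definition euclidean_ball :: "nat \<Rightarrow> (nat \<Rightarrow> real) set \<Rightarrow> bool" where
  "euclidean_ball n B \<longleftrightarrow> (\<exists>c \<in> topspace (Euclidean_space n). \<exists>\<rho>>0.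
     B = {x \<in> topspace (Euclidean_space n). sqrt (\<Sum>i<n. (x i - c i)\<^sup>2) < \<rho>})"

text \<open>Existence and continuity on the open set \<open>U \<subseteq> \<real>\<^sup>n \<times> Z\<close> of all partial derivatives with respect
  to the \<open>\<real>\<^sup>n\<close>-coordinates, up to order \<open>k\<close>, of a real-valued function. As \<open>U\<close> is open, the
  derivatives below depend only on the values on \<open>U\<close>.\<close>

primrec Ck_on ::
  "nat \<Rightarrow> nat \<Rightarrow> 'z topology \<Rightarrow> ((nat \<Rightarrow> real) \<times> 'z) set \<Rightarrow> ((nat \<Rightarrow> real) \<times> 'z \<Rightarrow> real) \<Rightarrow> bool"
where
  "Ck_on 0 n Z U g \<longleftrightarrow>
     continuous_map (subtopology (prod_topology (Euclidean_space n) Z) U) euclideanreal g"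
| "Ck_on (Suc k) n Z U g \<longleftrightarrow>
     continuous_map (subtopology (prod_topology (Euclidean_space n) Z) U) euclideanreal g \<and>
     (\<forall>i<n. \<exists>g'. (\<forall>(x, z) \<in> U. ((\<lambda>t. g (x(i := t), z)) has_real_derivative g' (x, z)) (at (x i)))
                \<and> Ck_on k n Z U g')"

definition Cr_on ::
  "enat \<Rightarrow> nat \<Rightarrow> 'z topology \<Rightarrow> ((nat \<Rightarrow> real) \<times> 'z) set \<Rightarrow> ((nat \<Rightarrow> real) \<times> 'z \<Rightarrow> nat \<Rightarrow> real) \<Rightarrow> bool"
where
  "Cr_on r n Z U f \<longleftrightarrow> f ` U \<subseteq> topspace (Euclidean_space n) \<and>
     (\<forall>i<n. \<forall>k. enat k \<le> r \<longrightarrow> Ck_on k n Z U (\<lambda>p. f p i))"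

definition Cr_foliated_map_on ::
  "enat \<Rightarrow> nat \<Rightarrow> 'z topology \<Rightarrow> 'w topology \<Rightarrow> ((nat \<Rightarrow> real) \<times> 'z) set \<Rightarrow>
   ((nat \<Rightarrow> real) \<times> 'z \<Rightarrow> (nat \<Rightarrow> real) \<times> 'w) \<Rightarrow> bool"
where
  "Cr_foliated_map_on r n Z Z' U h \<longleftrightarrow> (\<exists>h1 h2.
     (\<forall>(x, z) \<in> U. h (x, z) = (h1 (x, z), h2 z)) \<and>
     Cr_on r n Z U h1 \<and> continuous_map (subtopology Z (snd ` U)) Z' h2)"

definition locally_Cr_foliated_map_on ::
  "enat \<Rightarrow> nat \<Rightarrow> 'z topology \<Rightarrow> 'w topology \<Rightarrow> ((nat \<Rightarrow> real) \<times> 'z) set \<Rightarrow>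
   ((nat \<Rightarrow> real) \<times> 'z \<Rightarrow> (nat \<Rightarrow> real) \<times> 'w) \<Rightarrow> bool"
where
  "locally_Cr_foliated_map_on r n Z Z' U h \<longleftrightarrow> (\<forall>p \<in> U. \<exists>V.
     openin (prod_topology (Euclidean_space n) Z) V \<and> p \<in> V \<and> V \<subseteq> U \<and>
     Cr_foliated_map_on r n Z Z' V h)"

text \<open>A chart \<open>\<phi> : U \<rightarrow> B \<times> Z\<close> is the tuple \<open>(U, \<phi>, B, Z)\<close>. The transversals are spaces on subsets
  of one type \<open>'z\<close>; being separable metrizable they have at most continuum many points, so any type
  of at least that size hosts copies of all of them.\<close>

type_synonym ('a, 'z) foliated_chart =
  "'a set \<times> ('a \<Rightarrow> (nat \<Rightarrow> real) \<times> 'z) \<times> (nat \<Rightarrow> real) set \<times> 'z topology"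

definition foliated_chart :: "nat \<Rightarrow> 'a topology \<Rightarrow> ('a, 'z) foliated_chart \<Rightarrow> bool" where
  "foliated_chart n X c \<longleftrightarrow> (case c of (U, \<phi>, B, Z) \<Rightarrow>
     openin X U \<and> euclidean_ball n B \<and>
     locally_compact_space Z \<and> separable_space Z \<and> completely_metrizable_space Z \<and>
     homeomorphic_map (subtopology X U) (prod_topology (subtopology (Euclidean_space n) B) Z) \<phi>)"

definition foliated_atlas ::
  "enat \<Rightarrow> nat \<Rightarrow> 'a topology \<Rightarrow> ('a, 'z) foliated_chart set \<Rightarrow> bool" where
  "foliated_atlas r n X A \<longleftrightarrow>
     (\<forall>c \<in> A. foliated_chart n X c) \<and> (\<Union>(U, \<phi>, B, Z) \<in> A. U) = topspace X \<and>
     (\<forall>(U, \<phi>, B, Z) \<in> A. \<forall>(U', \<phi>', B', Z') \<in> A.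
        locally_Cr_foliated_map_on r n Z Z' (\<phi> ` (U \<inter> U')) (\<phi>' \<circ> inv_into U \<phi>))"

definition foliated_space ::
  "enat \<Rightarrow> nat \<Rightarrow> 'a topology \<Rightarrow> ('a, 'z) foliated_chart set \<Rightarrow> bool" where
  "foliated_space r n X A \<longleftrightarrow> foliated_atlas r n X A \<and>
     (\<forall>A'. foliated_atlas r n X A' \<and> A \<subseteq> A' \<longrightarrow> A' = A)"

definition plaques :: "('a, 'z) foliated_chart set \<Rightarrow> 'a set set" where
  "plaques A = {{x \<in> U. \<phi> x \<in> B \<times> {z}} | U \<phi> B Z z. (U, \<phi>, B, Z) \<in> A \<and> z \<in> topspace Z}"

definition leaf_topology :: "'a topology \<Rightarrow> ('a, 'z) foliated_chart set \<Rightarrow> 'a topology" where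
  "leaf_topology X A =
     topology_generated_by {V. \<exists>P \<in> plaques A. openin (subtopology X P) V}"

definition leaves :: "'a topology \<Rightarrow> ('a, 'z) foliated_chart set \<Rightarrow> 'a set set" where
  "leaves X A = connected_components_of (leaf_topology X A)"


section \<open>Continuous group actions\<close>

definition topological_group :: "('g, 'm) monoid_scheme \<Rightarrow> 'g topology \<Rightarrow> bool" where
  "topological_group G T \<longleftrightarrow> group G \<and> topspace T = carrier G \<and>
     continuous_map (prod_topology T T) T (\<lambda>(g, h). g \<otimes>\<^bsub>G\<^esub> h) \<and>
     continuous_map T T (\<lambda>g. inv\<^bsub>G\<^esub> g)"

definition continuous_group_action ::
  "('g, 'm) monoid_scheme \<Rightarrow> 'g topology \<Rightarrow> 'a topology \<Rightarrow> ('g \<Rightarrow> 'a \<Rightarrow> 'a) \<Rightarrow> bool" where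
  "continuous_group_action G T X \<phi> \<longleftrightarrow> topological_group G T \<and>
     group_action G (topspace X) \<phi> \<and> continuous_map (prod_topology T X) X (\<lambda>(g, x). \<phi> g x)"


section \<open>Decompositions\<close>

text \<open>A decomposition of \<open>X\<close> is a set \<open>F\<close> with \<open>partition_on (topspace X) F\<close>.\<close>

definition element_of :: "'a set set \<Rightarrow> 'a \<Rightarrow> 'a set" where
  "element_of F x = (THE L. L \<in> F \<and> x \<in> L)"

definition decomposition_space :: "'a topology \<Rightarrow> 'a set set \<Rightarrow> 'a set topology" where
  "decomposition_space X F = quotient_topology X (element_of F)"

definition saturation :: "'a topology \<Rightarrow> 'a set set \<Rightarrow> 'a set set \<Rightarrow> 'a set" where
  \<comment> \<open>inverse image under the quotient map \<open>X \<rightarrow> X/F\<close>\<close>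
  "saturation X F S = {x \<in> topspace X. element_of F x \<in> S}"

definition class_decomposition :: "'a topology \<Rightarrow> 'a set set \<Rightarrow> 'a set set" where
  "class_decomposition X F =
     {{x \<in> topspace X. X closure_of (element_of F x) = X closure_of L} | L. L \<in> F}"

definition invariant_under :: "'a set set \<Rightarrow> 'a set \<Rightarrow> bool" where
  "invariant_under D A \<longleftrightarrow> (\<exists>S \<subseteq> D. A = \<Union>S)"

definition closed_element :: "'a topology \<Rightarrow> 'a set \<Rightarrow> bool" where
  "closed_element X L \<longleftrightarrow> X closure_of L = L"

definition proper_element :: "'a topology \<Rightarrow> 'a set \<Rightarrow> bool" where
  "proper_element X L \<longleftrightarrow> closedin X (X closure_of L - L)"

definition closed_part :: "'a topology \<Rightarrow> 'a set set \<Rightarrow> 'a set" where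
  "closed_part X F = \<Union>{L \<in> F. closed_element X L}"

definition proper_part :: "'a topology \<Rightarrow> 'a set set \<Rightarrow> 'a set" where
  "proper_part X F = \<Union>{L \<in> F. \<not> closed_element X L \<and> proper_element X L}"

definition nonproper_part :: "'a topology \<Rightarrow> 'a set set \<Rightarrow> 'a set" where
  "nonproper_part X F = \<Union>{L \<in> F. \<not> proper_element X L}"

definition recurrent_part :: "'a topology \<Rightarrow> 'a set set \<Rightarrow> 'a set" where
  "recurrent_part X F = closed_part X F \<union> nonproper_part X F"

definition abstract_element :: "'a topology \<Rightarrow> 'a set set \<Rightarrow> 'a set \<Rightarrow> 'a set" where
  "abstract_element X F L = saturation X F
     (connected_component_of_set
       (subtopology (decomposition_space X F)
         (if L \<subseteq> closed_part X F \<union> proper_part X F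
          then {L' \<in> F. X closure_of L - L = X closure_of L' - L'}
          else {L' \<in> F. X closure_of L = X closure_of L'})) L)"

text \<open>Elements of a decomposition are compared in their subspace topologies.\<close>

definition abstract_weak_element :: "'a topology \<Rightarrow> 'a set set \<Rightarrow> 'a set \<Rightarrow> 'a set" where
  "abstract_weak_element X F L = saturation X F
     (connected_component_of_set
       (subtopology (decomposition_space X F)
         (if L \<subseteq> closed_part X F \<union> proper_part X F
          then {L' \<in> F. X closure_of L - L = X closure_of L' - L' \<and>
                        subtopology X L' homeomorphic_space subtopology X L}
          else {L' \<in> F. X closure_of L = X closure_of L' \<and>
                        subtopology X L' homeomorphic_space subtopology X L})) L)"

definition abstract_element_at :: "'a topology \<Rightarrow> 'a set set \<Rightarrow> 'a \<Rightarrow> 'a set" where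
  "abstract_element_at X F x = abstract_element X F (element_of F x)"

definition abstract_weak_element_at :: "'a topology \<Rightarrow> 'a set set \<Rightarrow> 'a \<Rightarrow> 'a set" where
  "abstract_weak_element_at X F x = abstract_weak_element X F (element_of F x)"

definition abstract_element_space :: "'a topology \<Rightarrow> 'a set set \<Rightarrow> 'a set topology" where
  "abstract_element_space X F = quotient_topology X (abstract_element_at X F)"

definition abstract_weak_element_space :: "'a topology \<Rightarrow> 'a set set \<Rightarrow> 'a set topology" where
  "abstract_weak_element_space X F = quotient_topology X (abstract_weak_element_at X F)"

definition nonmaximal_point :: "'a topology \<Rightarrow> 'a set set \<Rightarrow> 'a \<Rightarrow> bool" where
  "nonmaximal_point X F x \<longleftrightarrow>
     (\<exists>y \<in> topspace X. X closure_of (element_of F x) \<subset> X closure_of (element_of F y))"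

definition quasi_recurrent_part :: "'a topology \<Rightarrow> 'a set set \<Rightarrow> 'a set" where
  "quasi_recurrent_part X F = {x \<in> topspace X. \<exists>y \<in> abstract_element_at X F x.
     y \<in> recurrent_part X F \<or> nonmaximal_point X F y}"


section \<open>Morse hyper-graphs\<close>

text \<open>The vertices index themselves: \<open>\<Lambda>\<close> is the set of vertices and \<open>M\<^sub>\<lambda> = \<lambda>\<close>.\<close>

definition morse_vertices :: "'a topology \<Rightarrow> 'a set set \<Rightarrow> 'a set set" where
  "morse_vertices X F = saturation X F `
     connected_components_of (subtopology (decomposition_space X F)
       (element_of F ` quasi_recurrent_part X F))"

definition hyper_edge :: "'a topology \<Rightarrow> 'a set set \<Rightarrow> 'a set set \<Rightarrow> 'a set" where
  "hyper_edge X F I = {x \<in> topspace X - \<Union>(morse_vertices X F). \<exists>C.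
     disjoint_family_on C I \<and>
     (\<forall>M \<in> I. C M \<noteq> {} \<and> invariant_under (class_decomposition X F) (C M) \<and> C M \<subseteq> M) \<and>
     X closure_of (element_of F x) - element_of F x = (\<Union>M \<in> I. C M)}"

definition morse_hyper_graph :: "'a topology \<Rightarrow> 'a set set \<Rightarrow> 'a set set \<times> 'a set set set" where
  "morse_hyper_graph X F =
     (morse_vertices X F, {I. I \<subseteq> morse_vertices X F \<and> hyper_edge X F I \<noteq> {}})"

definition morse_hyper_graph_exists :: "'a topology \<Rightarrow> 'a set set \<Rightarrow> bool" where
  "morse_hyper_graph_exists X F \<longleftrightarrow>
     disjoint (morse_vertices X F) \<and>
     (\<forall>M \<in> morse_vertices X F. M \<noteq> {} \<and> invariant_under (class_decomposition X F) M) \<and>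
     disjoint_family_on (hyper_edge X F) (Pow (morse_vertices X F)) \<and>
     topspace X - \<Union>(morse_vertices X F) = (\<Union>I \<in> Pow (morse_vertices X F). hyper_edge X F I)"

definition morse_members :: "'a topology \<Rightarrow> 'a set set \<Rightarrow> 'a set set" where
  "morse_members X F =
     fst (morse_hyper_graph X F) \<union> hyper_edge X F ` snd (morse_hyper_graph X F)"

definition morse_hyper_graph_space :: "'a topology \<Rightarrow> 'a set set \<Rightarrow> 'a set topology" where
  "morse_hyper_graph_space X F = quotient_topology X (element_of (morse_members X F))"

end

theory Submission
  imports Defs
begin

text \<open>Everything follows from one property of the decomposition: the closure of an element is a union
  of elements. For orbits this holds because each group element acts as a continuous map preserving
  every orbit (\<open>saturated_closures_orbits\<close>). For leaves it holds because a leaf that accumulates at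
  one point of a plaque accumulates, by the local product structure, at every point of that plaque;
  so the closure of a leaf is both open and closed in the leaf topology and contains each leaf
  that it meets (\<open>saturated_closures_leaves\<close>).

  Assume this property, and let \<open>x\<close> not be quasi-recurrent, with element \<open>L\<close>. Then \<open>x\<close> is not in the
  recurrent part, so \<open>L\<close> is proper and its boundary \<open>cl L - L\<close> is a closed union of elements. The
  closure of an element in that boundary stays in the boundary, hence is strictly smaller than
  \<open>cl L\<close>: boundary points are non-maximal and so quasi-recurrent (\<open>boundary_subset_Q\<close>). The
  boundary is therefore cut into its traces on the vertices \<open>M\<^sub>\<lambda>\<close>. The traces are invariant under
  the class decomposition, because two elements with the same closure are topologically
  indistinguishable in the quotient space and thus lie in the same vertex
  (\<open>connectedin_same_closure\<close>, \<open>vertex_same_closure\<close>). Conversely the index set of any such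
  cutting can only be the set of vertices that the boundary meets, so every non-quasi-recurrent point
  lies in exactly one hyper-edge (\<open>hyper_edge_iff\<close>), and the hyper-graph exists.

  Abstract elements form a partition that refines both the vertices and the hyper-edges. An abstract
  element that meets the quasi-recurrent part is contained in it, since quasi-recurrence is defined in
  terms of the abstract element; its image in the quotient space is connected, so it lies in a single
  vertex. Outside the quasi-recurrent part all members of an abstract element have the same boundary,
  and the hyper-edge depends on the boundary alone. Abstract weak elements lie inside abstract
  elements, and a refinement induces a map of quotient spaces (\<open>quotient_map_of_refinement\<close>).\<close>

section \<open>Partitions and quotient spaces\<close>

lemma element_of_eq:
  assumes "partition_on S P" "L \<in> P" "x \<in> L"
  shows "element_of P x = L"
  unfolding element_of_def using assms
  by (intro the_equality) (auto simp: partition_on_def disjoint_def)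

lemma element_of_mem:
  assumes "partition_on S P" "x \<in> S"
  shows "element_of P x \<in> P" "x \<in> element_of P x"
proof -
  obtain L where "L \<in> P" "x \<in> L" using assms by (auto simp: partition_on_def)
  with element_of_eq[OF assms(1) this] show "element_of P x \<in> P" "x \<in> element_of P x" by simp_all
qed

text \<open>The values of \<open>f\<close> need not form a partition: that \<open>f x\<close> contains \<open>x\<close> and stays in one block of
  \<open>D\<close> is enough for the block to be determined by the value \<open>f x\<close>.\<close>

lemma quotient_map_of_refinement:
  assumes D: "partition_on (topspace X) D"
    and f: "\<And>x. x \<in> topspace X \<Longrightarrow> x \<in> f x \<and> f x \<subseteq> element_of D x"
  shows "\<exists>p. quotient_map (quotient_topology X f) (quotient_topology X (element_of D)) p \<and>
    (\<forall>x \<in> topspace X. p (f x) = element_of D x)"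
proof -
  define p where "p = (\<lambda>c. element_of D (inv_into (topspace X) f c))"
  have p: "p (f x) = element_of D x" if x: "x \<in> topspace X" for x
  proof -
    let ?y = "inv_into (topspace X) f (f x)"
    have y: "?y \<in> topspace X" "f ?y = f x"
      using inv_into_into[of "f x" f "topspace X"] f_inv_into_f[of "f x" f "topspace X"] x by simp_all
    have "x \<in> element_of D ?y" using f[OF x] f[OF y(1)] y(2) by auto
    then show ?thesis
      unfolding p_def using element_of_eq[OF D element_of_mem(1)[OF D y(1)]] by simp
  qed
  have 1: "quotient_map X (quotient_topology X f) f"
    by (rule quotient_map_quotient_topology)
  have "quotient_map X (quotient_topology X (element_of D)) (p \<circ> f)"
    using quotient_map_quotient_topology[of X "element_of D"] p
    by (rule_tac quotient_map_eq[where f="element_of D"]) auto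
  then have "quotient_map (quotient_topology X f) (quotient_topology X (element_of D)) p"
    using quotient_map_from_composition[OF quotient_imp_continuous_map[OF 1]]
      continuous_compose_quotient_map[OF 1] quotient_imp_continuous_map by blast
  with p show ?thesis by blast
qed


section \<open>Decompositions whose elements have saturated closures\<close>

locale saturated_closures =
  fixes X :: "'a topology" and F :: "'a set set"
  assumes partition: "partition_on (topspace X) F"
    and closure_saturated:
      "\<And>L L'. \<lbrakk>L \<in> F; L' \<in> F; L' \<inter> X closure_of L \<noteq> {}\<rbrakk> \<Longrightarrow> L' \<subseteq> X closure_of L"
begin

abbreviation el :: "'a \<Rightarrow> 'a set" where "el \<equiv> element_of F"
abbreviation cl :: "'a set \<Rightarrow> 'a set" where "cl L \<equiv> X closure_of L"
abbreviation DS :: "'a set topology" where "DS \<equiv> decomposition_space X F"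
abbreviation Q :: "'a set" where "Q \<equiv> quasi_recurrent_part X F"

lemma el_mem: "x \<in> topspace X \<Longrightarrow> el x \<in> F" "x \<in> topspace X \<Longrightarrow> x \<in> el x"
  using element_of_mem[OF partition] by auto

lemma el_eq: "L \<in> F \<Longrightarrow> x \<in> L \<Longrightarrow> el x = L"
  by (rule element_of_eq[OF partition])

lemma el_subset: "L \<in> F \<Longrightarrow> L \<subseteq> topspace X"
  and el_nonempty: "L \<in> F \<Longrightarrow> L \<noteq> {}"
  and el_disjoint: "L \<in> F \<Longrightarrow> L' \<in> F \<Longrightarrow> L \<noteq> L' \<Longrightarrow> L \<inter> L' = {}"
  using partition by (auto simp: partition_on_def disjoint_def)

lemma subset_cl: "L \<in> F \<Longrightarrow> L \<subseteq> cl L"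
  by (simp add: closure_of_subset el_subset)

lemma topspace_DS: "topspace DS = F"
proof -
  have "L \<in> el ` topspace X" if "L \<in> F" for L
    using el_nonempty[OF that] el_eq[OF that] el_subset[OF that] by blast
  then show ?thesis
    unfolding decomposition_space_def topspace_quotient_topology using el_mem by blast
qed

lemma proper_if_closed: "closed_element X L \<Longrightarrow> proper_element X L"
  by (simp add: closed_element_def proper_element_def)

text \<open>If \<open>L\<close> were proper, the closed set \<open>cl L - L\<close> would contain the disjoint element \<open>L'\<close> and with
  it \<open>cl L' = cl L\<close>, leaving no room for \<open>L\<close>. Hence the elements sharing their closure with a
  different element all belong to the non-proper part.\<close>

lemma not_proper_if_same_closure:
  assumes "L \<in> F" "L' \<in> F" "L \<noteq> L'" "cl L = cl L'"
  shows "\<not> proper_element X L"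
proof
  assume "proper_element X L"
  then have "closedin X (cl L - L)" by (simp add: proper_element_def)
  moreover have "L' \<subseteq> cl L - L" using assms el_disjoint subset_cl by blast
  ultimately have "cl L' \<subseteq> cl L - L" by (simp add: closure_of_minimal)
  then show False using subset_cl[OF assms(1)] el_nonempty[OF assms(1)] assms(4) by blast
qed

lemma subset_parts_iff:
  assumes "L \<in> F"
  shows "L \<subseteq> closed_part X F \<union> proper_part X F \<longleftrightarrow> proper_element X L"
proof
  assume L: "L \<subseteq> closed_part X F \<union> proper_part X F"
  obtain x where x: "x \<in> L" using el_nonempty[OF assms] by blast
  then obtain L' where "L' \<in> F" "x \<in> L'" "closed_element X L' \<or> proper_element X L'"
    using L by (auto simp: closed_part_def proper_part_def)
  then show "proper_element X L"
    using el_disjoint[OF assms, of L'] x proper_if_closed by blast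
next
  assume "proper_element X L"
  with assms show "L \<subseteq> closed_part X F \<union> proper_part X F"
    unfolding closed_part_def proper_part_def by blast
qed

lemma mem_recurrent_part:
  assumes "x \<in> topspace X" "closed_element X (el x) \<or> \<not> proper_element X (el x)"
  shows "x \<in> recurrent_part X F"
  using assms el_mem[OF assms(1)]
  by (auto simp: recurrent_part_def closed_part_def nonproper_part_def)


subsection \<open>Abstract elements and quasi-recurrent points\<close>

text \<open>The subspace of the quotient space whose component through \<open>L\<close> gives the abstract element of \<open>L\<close>.
  Closed elements are proper, with empty boundary, so the case distinction is one on properness.\<close>

definition companions :: "'a set \<Rightarrow> 'a set set" where
  "companions L = (if proper_element X L then {L' \<in> F. cl L - L = cl L' - L'}
                   else {L' \<in> F. cl L = cl L'})"

text \<open>Being companions is an equivalence relation, because both cases of the definition are stable: the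
  boundary determines properness, and an element with the closure of a non-proper one
  is non-proper by \<open>not_proper_if_same_closure\<close>. This is what makes abstract elements a partition.\<close>

lemma companions_eq:
  assumes L: "L \<in> F" and L': "L' \<in> companions L"
  shows "companions L' = companions L"
proof (cases "proper_element X L")
  case True
  with L' have eq: "cl L - L = cl L' - L'" by (simp add: companions_def)
  with True have "proper_element X L'" by (simp add: proper_element_def)
  with True eq show ?thesis by (simp add: companions_def)
next
  case False
  with L' have eq: "cl L = cl L'" "L' \<in> F" by (simp_all add: companions_def)
  have "\<not> proper_element X L'"
    using not_proper_if_same_closure[of L' L] eq L False by auto
  with False eq show ?thesis by (simp add: companions_def)
qed

lemma abstract_element_eq:
  assumes "L \<in> F"
  shows "abstract_element X F L =
    saturation X F (connected_component_of_set (subtopology DS (companions L)) L)"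
  unfolding abstract_element_def companions_def subset_parts_iff[OF assms] ..

lemma abstract_weak_element_eq:
  assumes "L \<in> F"
  shows "abstract_weak_element X F L =
    saturation X F (connected_component_of_set (subtopology DS
      {L' \<in> companions L. subtopology X L' homeomorphic_space subtopology X L}) L)"
proof -
  have "{L' \<in> companions L. subtopology X L' homeomorphic_space subtopology X L} =
    (if proper_element X L
     then {L' \<in> F. cl L - L = cl L' - L' \<and> subtopology X L' homeomorphic_space subtopology X L}
     else {L' \<in> F. cl L = cl L' \<and> subtopology X L' homeomorphic_space subtopology X L})"
    by (auto simp: companions_def)
  then show ?thesis
    unfolding abstract_weak_element_def subset_parts_iff[OF assms] by simp
qed

lemma companions_refl: "L \<in> F \<Longrightarrow> L \<in> companions L"
  by (simp add: companions_def)

lemma mem_abstract_weak_element_at: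
  assumes "x \<in> topspace X"
  shows "x \<in> abstract_weak_element_at X F x"
proof -
  have "el x \<in> topspace (subtopology DS
      {L' \<in> companions (el x). subtopology X L' homeomorphic_space subtopology X (el x)})"
    using el_mem[OF assms] companions_refl by (simp add: topspace_DS homeomorphic_space_refl)
  then show ?thesis
    using assms el_mem[OF assms]
    by (simp add: abstract_weak_element_at_def abstract_weak_element_eq saturation_def
        connected_component_of_refl)
qed

lemma abstract_weak_element_at_subset:
  assumes "x \<in> topspace X"
  shows "abstract_weak_element_at X F x \<subseteq> abstract_element_at X F x"
  unfolding abstract_weak_element_at_def abstract_element_at_def
    abstract_weak_element_eq[OF el_mem(1)[OF assms]] abstract_element_eq[OF el_mem(1)[OF assms]]
    saturation_def
  by (auto elim: connected_component_of_mono)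

lemma mem_abstract_element_at:
  "x \<in> topspace X \<Longrightarrow> x \<in> abstract_element_at X F x"
  using mem_abstract_weak_element_at abstract_weak_element_at_subset by blast

lemma abstract_element_at_companion:
  assumes x: "x \<in> topspace X" and y: "y \<in> abstract_element_at X F x"
  shows "y \<in> topspace X" "el y \<in> companions (el x)"
    "abstract_element_at X F y = abstract_element_at X F x"
proof -
  have c: "connected_component_of (subtopology DS (companions (el x))) (el x) (el y)"
    and yX: "y \<in> topspace X"
    using y unfolding abstract_element_at_def abstract_element_eq[OF el_mem(1)[OF x]]
    by (auto simp: saturation_def)
  show "y \<in> topspace X" by (rule yX)
  show comp: "el y \<in> companions (el x)"
    using connected_component_in_topspace[OF c] by simp
  show "abstract_element_at X F y = abstract_element_at X F x"
    unfolding abstract_element_at_def abstract_element_eq[OF el_mem(1)[OF x]]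
      abstract_element_eq[OF el_mem(1)[OF yX]] companions_eq[OF el_mem(1)[OF x] comp]
    using c by (metis connected_component_of_equiv)
qed

lemma abstract_element_at_same_element:
  "el x = el y \<Longrightarrow> abstract_element_at X F x = abstract_element_at X F y"
  by (simp add: abstract_element_at_def)

text \<open>Quasi-recurrence is a property of the abstract element of a point, so the quasi-recurrent part is
  a union of abstract elements, and in particular of elements.\<close>

lemma mem_Q_cong:
  assumes "x \<in> topspace X" "y \<in> topspace X"
    "abstract_element_at X F x = abstract_element_at X F y"
  shows "x \<in> Q \<longleftrightarrow> y \<in> Q"
  using assms by (simp add: quasi_recurrent_part_def)

lemma Q_subset: "Q \<subseteq> topspace X"
  by (auto simp: quasi_recurrent_part_def)

lemma mem_Q_iff:
  assumes "x \<in> topspace X"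
  shows "x \<in> Q \<longleftrightarrow> el x \<in> el ` Q"
proof
  assume "el x \<in> el ` Q"
  then obtain y where y: "y \<in> Q" "el x = el y" by blast
  then show "x \<in> Q"
    using mem_Q_cong[OF assms _ abstract_element_at_same_element] Q_subset by blast
qed blast

lemma recurrent_in_Q: "x \<in> topspace X \<Longrightarrow> x \<in> recurrent_part X F \<Longrightarrow> x \<in> Q"
  and nonmaximal_in_Q: "x \<in> topspace X \<Longrightarrow> nonmaximal_point X F x \<Longrightarrow> x \<in> Q"
  using mem_abstract_element_at by (auto simp: quasi_recurrent_part_def)

lemma outside_Q_proper:
  assumes "x \<in> topspace X" "x \<notin> Q"
  shows "proper_element X (el x)"
  using assms mem_recurrent_part recurrent_in_Q by blast

lemma boundary_closed_saturated:
  assumes L: "L \<in> F" "proper_element X L" and y: "y \<in> cl L - L"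
  shows "cl (el y) \<subseteq> cl L - L"
proof (rule closure_of_minimal)
  have yX: "y \<in> topspace X" using y in_closure_of by fastforce
  show "el y \<subseteq> cl L - L"
    using closure_saturated[OF L(1) el_mem(1)[OF yX]] el_mem[OF yX] y el_disjoint[of L "el y"] L(1)
    by blast
  show "closedin X (cl L - L)" using L(2) by (simp add: proper_element_def)
qed

text \<open>A boundary point \<open>y\<close> has \<open>cl (el y)\<close> inside \<open>cl (el x) - el x\<close>, which misses \<open>x\<close>; so the inclusion
  of closures is strict and \<open>y\<close> is non-maximal.\<close>

lemma boundary_subset_Q:
  assumes x: "x \<in> topspace X" "x \<notin> Q"
  shows "cl (el x) - el x \<subseteq> Q"
proof
  fix y assume y: "y \<in> cl (el x) - el x"
  then have yX: "y \<in> topspace X" using in_closure_of by fastforce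
  have "cl (el y) \<subseteq> cl (el x) - el x"
    using boundary_closed_saturated[OF el_mem(1)[OF x(1)] outside_Q_proper[OF x] y] .
  moreover have "x \<in> cl (el x)" "x \<in> el x" using subset_cl el_mem[OF x(1)] by blast+
  ultimately have "nonmaximal_point X F y" using x(1) unfolding nonmaximal_point_def by blast
  then show "y \<in> Q" using nonmaximal_in_Q[OF yX] by blast
qed

text \<open>Two points with different elements of equal closure are both non-proper, hence recurrent; the
  remaining case is that of two points of one element.\<close>

lemma same_closure_in_Q:
  assumes "x \<in> Q" "y \<in> topspace X" "cl (el x) = cl (el y)"
  shows "y \<in> Q"
proof (cases "el x = el y")
  case True
  then show ?thesis using assms mem_Q_iff by (metis imageI)
next
  case False
  then have "\<not> proper_element X (el y)"
    using not_proper_if_same_closure[of "el y" "el x"] assms el_mem Q_subset by auto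
  then show ?thesis using assms mem_recurrent_part recurrent_in_Q by blast
qed

text \<open>An open set of the quotient space is a saturated open set of \<open>X\<close>. If it contains \<open>el x\<close>, and \<open>x\<close> is
  in the closure of \<open>el y\<close>, then it meets and so contains \<open>el y\<close>. Elements of equal closure thus
  have the same neighbourhoods, and a set of indistinguishable points is connected.\<close>

lemma connectedin_same_closure:
  assumes x: "x \<in> topspace X" and y: "y \<in> topspace X" and eq: "cl (el x) = cl (el y)"
  shows "connectedin DS {el x, el y}"
proof -
  have *: "el v \<in> E" if E: "openin DS E" "el u \<in> E" and u: "u \<in> topspace X" "v \<in> topspace X"
    and uv: "cl (el u) = cl (el v)" for u v E
  proof -
    have "openin X {w \<in> topspace X. el w \<in> E}"
      using E(1) unfolding decomposition_space_def openin_quotient_topology by blast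
    moreover have "u \<in> cl (el v)"
      using uv subset_cl[OF el_mem(1)[OF u(1)]] el_mem(2)[OF u(1)] by auto
    moreover have "u \<in> {w \<in> topspace X. el w \<in> E}" using u(1) E(2) by simp
    ultimately have "\<exists>w. w \<in> el v \<and> w \<in> {w \<in> topspace X. el w \<in> E}"
      unfolding in_closure_of[of u] by metis
    then obtain w where w: "w \<in> el v" "el w \<in> E" by blast
    have "el w = el v" by (rule el_eq[OF el_mem(1)[OF u(2)] w(1)])
    then show ?thesis using w(2) by simp
  qed
  show ?thesis
    unfolding connectedin topspace_DS
  proof (intro conjI notI)
    show "{el x, el y} \<subseteq> F" using el_mem x y by simp
    assume "\<exists>E1 E2. openin DS E1 \<and> openin DS E2 \<and> {el x, el y} \<subseteq> E1 \<union> E2 \<and>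
      E1 \<inter> E2 \<inter> {el x, el y} = {} \<and> E1 \<inter> {el x, el y} \<noteq> {} \<and> E2 \<inter> {el x, el y} \<noteq> {}"
    then obtain E1 E2 where E: "openin DS E1" "openin DS E2" "E1 \<inter> E2 \<inter> {el x, el y} = {}"
      "E1 \<inter> {el x, el y} \<noteq> {}" "E2 \<inter> {el x, el y} \<noteq> {}" by metis
    have "el x \<in> E" if "openin DS E" "E \<inter> {el x, el y} \<noteq> {}" for E
      using that(2) *[OF that(1) _ y x eq[symmetric]] by auto
    then show False using E by auto
  qed
qed


subsection \<open>Vertices of the Morse hyper-graph\<close>

lemma vertices_eq: "morse_vertices X F =
    saturation X F ` connected_components_of (subtopology DS (el ` Q))"
  by (simp add: morse_vertices_def)

lemma Union_vertices: "\<Union>(morse_vertices X F) = Q"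
proof -
  have "\<Union>(morse_vertices X F) =
      saturation X F (\<Union>(connected_components_of (subtopology DS (el ` Q))))"
    unfolding vertices_eq saturation_def by blast
  also have "\<dots> = saturation X F (el ` Q)"
    using el_mem Q_subset by (auto simp: Union_connected_components_of topspace_DS saturation_def)
  also have "\<dots> = Q"
    using Q_subset mem_Q_iff by (auto simp: saturation_def)
  finally show ?thesis .
qed

lemma disjoint_vertices: "disjoint (morse_vertices X F)"
proof (rule disjointI)
  fix M N assume "M \<in> morse_vertices X F" "N \<in> morse_vertices X F" "M \<noteq> N"
  then obtain C D where "M = saturation X F C" "N = saturation X F D" "C \<noteq> D"
    "C \<in> connected_components_of (subtopology DS (el ` Q))"
    "D \<in> connected_components_of (subtopology DS (el ` Q))"
    unfolding vertices_eq by blast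
  moreover from this have "disjnt C D"
    using pairwise_disjoint_connected_components_of by (metis pairwise_def)
  ultimately show "M \<inter> N = {}" by (auto simp: saturation_def disjnt_def)
qed

lemma vertex_nonempty:
  assumes "M \<in> morse_vertices X F"
  shows "M \<noteq> {}"
proof -
  obtain C where C: "M = saturation X F C" "C \<in> connected_components_of (subtopology DS (el ` Q))"
    using assms unfolding vertices_eq by blast
  then obtain L where L: "L \<in> C" using nonempty_connected_components_of by blast
  with C have "L \<in> F"
    using connected_components_of_subset by (fastforce simp: topspace_DS)
  then obtain x where x: "x \<in> L" "x \<in> topspace X" using el_nonempty el_subset by blast
  then have "el x = L" using el_eq[OF \<open>L \<in> F\<close>] by blast
  then show ?thesis using x L C by (auto simp: saturation_def)
qed

lemma connected_saturation_subset_vertex: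
  assumes M: "M \<in> morse_vertices X F" "x \<in> M"
    and K: "connectedin DS K" "K \<subseteq> el ` Q" "el x \<in> K"
  shows "saturation X F K \<subseteq> M"
proof -
  obtain C where C: "M = saturation X F C" "C \<in> connected_components_of (subtopology DS (el ` Q))"
    using M unfolding vertices_eq by blast
  have "connectedin (subtopology DS (el ` Q)) K" using K by (simp add: connectedin_subtopology)
  moreover have "\<not> disjnt C K" using M(2) C(1) K(3) by (auto simp: saturation_def disjnt_iff)
  ultimately have "K \<subseteq> C" using connected_components_of_maximal C(2) by blast
  then show ?thesis using C(1) by (auto simp: saturation_def)
qed

lemma vertex_same_closure:
  assumes M: "M \<in> morse_vertices X F" "x \<in> M" and y: "y \<in> topspace X" "cl (el x) = cl (el y)"
  shows "y \<in> M"
proof -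
  have x: "x \<in> Q" using M Union_vertices by blast
  then have "y \<in> Q" using same_closure_in_Q y by blast
  then have "saturation X F {el x, el y} \<subseteq> M"
    using connected_saturation_subset_vertex[OF M connectedin_same_closure] x y Q_subset by blast
  then show ?thesis using y by (auto simp: saturation_def)
qed

text \<open>The image of an abstract element in the quotient space is a component of a subspace of companions.
  It stays inside the image of the quasi-recurrent part once it meets it, so that connectedness
  confines it to one component there.\<close>

lemma abstract_element_at_subset_vertex:
  assumes M: "M \<in> morse_vertices X F" "x \<in> M"
  shows "abstract_element_at X F x \<subseteq> M"
proof -
  have x: "x \<in> Q" "x \<in> topspace X" using M Union_vertices Q_subset by blast+
  define K where "K = connected_component_of_set (subtopology DS (companions (el x))) (el x)"
  have sat: "abstract_element_at X F x = saturation X F K"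
    using el_mem x by (simp add: abstract_element_at_def abstract_element_eq K_def)
  have KF: "connectedin DS K"
    using connectedin_connected_component_of[of "subtopology DS (companions (el x))" "el x"]
    by (simp add: K_def connectedin_subtopology)
  have "el x \<in> K" using mem_abstract_element_at[OF x(2)] sat by (simp add: saturation_def)
  moreover have "K \<subseteq> el ` Q"
  proof
    fix L assume L: "L \<in> K"
    then have LF: "L \<in> F" using connectedin_subset_topspace[OF KF] topspace_DS by blast
    then obtain y where y: "y \<in> L" "y \<in> topspace X" using el_nonempty el_subset by blast
    then have ey: "el y = L" using el_eq LF by blast
    then have "y \<in> abstract_element_at X F x" using sat L y by (simp add: saturation_def)
    then have "y \<in> Q"
      using abstract_element_at_companion[OF x(2)] mem_Q_cong[OF x(2) y(2)] x(1) by simp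
    then show "L \<in> el ` Q" using ey by blast
  qed
  ultimately show ?thesis
    using connected_saturation_subset_vertex[OF M KF] sat by simp
qed

lemma invariant_under_classI:
  assumes "B \<subseteq> topspace X"
    and "\<And>x y. \<lbrakk>x \<in> B; y \<in> topspace X; cl (el x) = cl (el y)\<rbrakk> \<Longrightarrow> y \<in> B"
  shows "invariant_under (class_decomposition X F) B"
  unfolding invariant_under_def
proof (intro exI conjI)
  let ?S = "(\<lambda>x. {y \<in> topspace X. cl (el y) = cl (el x)}) ` B"
  show "?S \<subseteq> class_decomposition X F"
    using assms(1) el_mem unfolding class_decomposition_def by blast
  show "B = \<Union>?S"
  proof
    show "B \<subseteq> \<Union>?S" using assms(1) by blast
    show "\<Union>?S \<subseteq> B" using assms(2) by (auto dest: sym)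
  qed
qed

lemma vertex_invariant:
  assumes "M \<in> morse_vertices X F"
  shows "invariant_under (class_decomposition X F) M"
proof (rule invariant_under_classI)
  show "M \<subseteq> topspace X" using assms Union_vertices Q_subset by blast
qed (rule vertex_same_closure[OF assms])


subsection \<open>Hyper-edges and the quotient maps\<close>

text \<open>The only index set that can occur for \<open>x\<close>: the vertices are disjoint, so a family of non-empty
  pieces of vertices with union the boundary must be the family of traces of the boundary.\<close>

definition limit_vertices :: "'a \<Rightarrow> 'a set set" where
  "limit_vertices x = {M \<in> morse_vertices X F. M \<inter> (cl (el x) - el x) \<noteq> {}}"

lemma hyper_edge_iff:
  assumes I: "I \<subseteq> morse_vertices X F"
  shows "x \<in> hyper_edge X F I \<longleftrightarrow> x \<in> topspace X - Q \<and> I = limit_vertices x"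
proof
  assume "x \<in> hyper_edge X F I"
  then obtain C where x: "x \<in> topspace X - Q"
    and C: "\<And>M. M \<in> I \<Longrightarrow> C M \<noteq> {} \<and> C M \<subseteq> M"
    and bd: "cl (el x) - el x = (\<Union>M \<in> I. C M)"
    unfolding hyper_edge_def Union_vertices by blast
  have "limit_vertices x \<subseteq> I"
  proof
    fix M assume "M \<in> limit_vertices x"
    then obtain y N where M: "M \<in> morse_vertices X F" "y \<in> M" and N: "N \<in> I" "y \<in> C N"
      unfolding limit_vertices_def bd by blast
    then have "M \<inter> N \<noteq> {}" using C by blast
    then have "M = N" using disjointD[OF disjoint_vertices M(1)] N I by blast
    then show "M \<in> I" using N by simp
  qed
  moreover have "I \<subseteq> limit_vertices x"
    unfolding limit_vertices_def bd using C I by blast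
  ultimately show "x \<in> topspace X - Q \<and> I = limit_vertices x" using x by blast
next
  assume "x \<in> topspace X - Q \<and> I = limit_vertices x"
  then have x: "x \<in> topspace X" "x \<notin> Q" and I_eq: "I = limit_vertices x" by auto
  let ?bd = "cl (el x) - el x"
  have "disjoint_family_on (\<lambda>M. M \<inter> ?bd) I"
    unfolding disjoint_family_on_def using disjointD[OF disjoint_vertices] I by blast
  moreover have "M \<inter> ?bd \<noteq> {} \<and> invariant_under (class_decomposition X F) (M \<inter> ?bd) \<and> M \<inter> ?bd \<subseteq> M"
    if M: "M \<in> I" for M
  proof (intro conjI invariant_under_classI)
    show "M \<inter> ?bd \<noteq> {}" using M I_eq by (simp add: limit_vertices_def)
    have MV: "M \<in> morse_vertices X F" using M I by blast
    show "M \<inter> ?bd \<subseteq> topspace X" using MV Union_vertices Q_subset by blast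
    fix y y' assume y: "y \<in> M \<inter> ?bd" and y': "y' \<in> topspace X" "cl (el y) = cl (el y')"
    have "y' \<in> cl (el y)" using subset_cl el_mem y' by blast
    then have "y' \<in> ?bd"
      using boundary_closed_saturated[OF el_mem(1)[OF x(1)] outside_Q_proper[OF x]] y by blast
    moreover have "y' \<in> M" using vertex_same_closure[OF MV _ y'] y by blast
    ultimately show "y' \<in> M \<inter> ?bd" by blast
  qed auto
  moreover have "?bd = (\<Union>M \<in> I. M \<inter> ?bd)"
    using boundary_subset_Q[OF x] Union_vertices unfolding I_eq limit_vertices_def by blast
  ultimately show "x \<in> hyper_edge X F I"
    unfolding hyper_edge_def Union_vertices using x by blast
qed

lemma limit_vertices_subset: "limit_vertices x \<subseteq> morse_vertices X F"
  by (auto simp: limit_vertices_def)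

lemma morse_hyper_graph_exists: "morse_hyper_graph_exists X F"
  unfolding morse_hyper_graph_exists_def Union_vertices
proof (intro conjI ballI)
  show "disjoint_family_on (hyper_edge X F) (Pow (morse_vertices X F))"
    by (auto simp: disjoint_family_on_def hyper_edge_iff)
  show "topspace X - Q = (\<Union>I \<in> Pow (morse_vertices X F). hyper_edge X F I)"
    using limit_vertices_subset by (auto simp: hyper_edge_iff)
qed (use disjoint_vertices vertex_nonempty vertex_invariant in auto)

lemma morse_members_eq: "morse_members X F = morse_vertices X F \<union>
    {hyper_edge X F I | I. I \<subseteq> morse_vertices X F \<and> hyper_edge X F I \<noteq> {}}"
  by (auto simp: morse_members_def morse_hyper_graph_def)

lemma partition_morse_members: "partition_on (topspace X) (morse_members X F)"
proof (rule partition_onI)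
  have "\<Union>(morse_members X F) = Q \<union> (\<Union>I \<in> Pow (morse_vertices X F). hyper_edge X F I)"
    unfolding morse_members_eq Union_vertices[symmetric] by blast
  also have "\<dots> = topspace X"
    using morse_hyper_graph_exists Q_subset
    unfolding morse_hyper_graph_exists_def Union_vertices by blast
  finally show "\<Union>(morse_members X F) = topspace X" .
  show "{} \<notin> morse_members X F"
    unfolding morse_members_eq using vertex_nonempty by blast
  have edge: "hyper_edge X F I \<inter> Q = {}" if "I \<subseteq> morse_vertices X F" for I
    using hyper_edge_iff[OF that] by blast
  fix M N assume MN: "M \<in> morse_members X F" "N \<in> morse_members X F" "M \<noteq> N"
  show "disjnt M N"
  proof (rule ccontr)
    assume "\<not> disjnt M N"
    then obtain x where x: "x \<in> M" "x \<in> N" by (auto simp: disjnt_iff)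
    show False
    proof (cases "x \<in> Q")
      case True
      then have "M \<in> morse_vertices X F" "N \<in> morse_vertices X F"
        using MN x edge unfolding morse_members_eq by blast+
      then show False using disjointD[OF disjoint_vertices] MN(3) x by blast
    next
      case False
      then obtain I J where IJ: "M = hyper_edge X F I" "N = hyper_edge X F J"
        "I \<subseteq> morse_vertices X F" "J \<subseteq> morse_vertices X F"
        using MN x Union_vertices unfolding morse_members_eq by blast
      then have "I = limit_vertices x" "J = limit_vertices x"
        using x hyper_edge_iff[OF IJ(3)] hyper_edge_iff[OF IJ(4)] by simp_all
      then show False using IJ(1,2) MN(3) by simp
    qed
  qed
qed

text \<open>On the quasi-recurrent part this is \<open>abstract_element_at_subset_vertex\<close>. Elsewhere the companions of
  a proper element are those with the same boundary, and the boundary alone determines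
  \<open>limit_vertices\<close>.\<close>

lemma abstract_element_at_subset_member:
  assumes x: "x \<in> topspace X"
  shows "abstract_element_at X F x \<subseteq> element_of (morse_members X F) x"
proof (cases "x \<in> Q")
  case True
  then obtain M where M: "M \<in> morse_vertices X F" "x \<in> M" using Union_vertices by blast
  then have "element_of (morse_members X F) x = M"
    using element_of_eq[OF partition_morse_members] by (simp add: morse_members_eq)
  then show ?thesis using abstract_element_at_subset_vertex[OF M] by simp
next
  case False
  let ?H = "hyper_edge X F (limit_vertices x)"
  have xH: "x \<in> ?H" using hyper_edge_iff[OF limit_vertices_subset] x False by blast
  then have "?H \<in> morse_members X F" unfolding morse_members_eq using limit_vertices_subset by blast
  then have "element_of (morse_members X F) x = ?H"
    using element_of_eq[OF partition_morse_members] xH by blast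
  moreover have "y \<in> ?H" if y: "y \<in> abstract_element_at X F x" for y
  proof -
    note y' = abstract_element_at_companion[OF x y]
    have "cl (el x) - el x = cl (el y) - el y"
      using y'(2) outside_Q_proper[OF x False] by (simp add: companions_def)
    then have "limit_vertices y = limit_vertices x" by (simp add: limit_vertices_def)
    moreover have "y \<notin> Q" using mem_Q_cong[OF x y'(1)] y'(3) False by simp
    ultimately show ?thesis
      using hyper_edge_iff[OF limit_vertices_subset] y'(1) by blast
  qed
  ultimately show ?thesis by blast
qed

lemma unique_member_containing:
  assumes x: "x \<in> topspace X" and B: "x \<in> B" "B \<subseteq> element_of (morse_members X F) x"
  shows "\<exists>!D. D \<in> morse_members X F \<and> B \<subseteq> D"
proof (rule ex1I)
  show "element_of (morse_members X F) x \<in> morse_members X F \<and> B \<subseteq> element_of (morse_members X F) x"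
    using element_of_mem[OF partition_morse_members x] B by blast
  show "D = element_of (morse_members X F) x" if "D \<in> morse_members X F \<and> B \<subseteq> D" for D
    using element_of_eq[OF partition_morse_members] that B by blast
qed

theorem morse_hyper_graph_quotient:
  "morse_hyper_graph_exists X F \<and>
    partition_on (topspace X) (morse_members X F) \<and>
    (\<forall>x \<in> topspace X. \<exists>!D. D \<in> morse_members X F \<and> abstract_element_at X F x \<subseteq> D) \<and>
    (\<forall>x \<in> topspace X. \<exists>!D. D \<in> morse_members X F \<and> abstract_weak_element_at X F x \<subseteq> D) \<and>
    (\<exists>p. quotient_map (abstract_element_space X F) (morse_hyper_graph_space X F) p \<and>
      (\<forall>x \<in> topspace X. p (abstract_element_at X F x) = element_of (morse_members X F) x)) \<and>
    (\<exists>p. quotient_map (abstract_weak_element_space X F) (morse_hyper_graph_space X F) p \<and>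
      (\<forall>x \<in> topspace X. p (abstract_weak_element_at X F x) = element_of (morse_members X F) x))"
proof -
  have strong: "x \<in> abstract_element_at X F x \<and>
      abstract_element_at X F x \<subseteq> element_of (morse_members X F) x"
    if "x \<in> topspace X" for x
    using that mem_abstract_element_at abstract_element_at_subset_member by blast
  have weak: "x \<in> abstract_weak_element_at X F x \<and>
      abstract_weak_element_at X F x \<subseteq> element_of (morse_members X F) x"
    if "x \<in> topspace X" for x
    using that mem_abstract_weak_element_at abstract_weak_element_at_subset strong by blast
  show ?thesis
    unfolding abstract_element_space_def abstract_weak_element_space_def morse_hyper_graph_space_def
  proof (intro conjI ballI)
    fix x assume x: "x \<in> topspace X"
    show "\<exists>!D. D \<in> morse_members X F \<and> abstract_element_at X F x \<subseteq> D"
      using unique_member_containing[OF x] strong[OF x] by simp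
    show "\<exists>!D. D \<in> morse_members X F \<and> abstract_weak_element_at X F x \<subseteq> D"
      using unique_member_containing[OF x] weak[OF x] by simp
  qed (rule morse_hyper_graph_exists partition_morse_members
      quotient_map_of_refinement[OF partition_morse_members strong]
      quotient_map_of_refinement[OF partition_morse_members weak]; assumption)+
qed

end


section \<open>Orbits of continuous group actions\<close>

lemma saturated_closures_orbits:
  assumes "continuous_group_action G T X \<phi>"
  shows "saturated_closures X (orbits G (topspace X) \<phi>)"
proof -
  interpret group_action G "topspace X" \<phi>
    using assms by (simp add: continuous_group_action_def)
  have T: "topspace T = carrier G" and
    cont: "continuous_map (prod_topology T X) X (\<lambda>(g, x). \<phi> g x)"
    using assms by (auto simp: continuous_group_action_def topological_group_def)
  show ?thesis
  proof
    show "partition_on (topspace X) (orbits G (topspace X) \<phi>)"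
    proof (rule partition_onI)
      show "\<Union>(orbits G (topspace X) \<phi>) = topspace X"
        by (rule orbits_coverture)
      show "{} \<notin> orbits G (topspace X) \<phi>"
        using orbit_refl unfolding orbits_def by blast
      fix p q assume "p \<in> orbits G (topspace X) \<phi>" "q \<in> orbits G (topspace X) \<phi>" "p \<noteq> q"
      then show "disjnt p q"
        using disjoint_union unfolding disjnt_def by blast
    qed
  next
    fix L L' assume L: "L \<in> orbits G (topspace X) \<phi>" and L': "L' \<in> orbits G (topspace X) \<phi>"
      and "L' \<inter> X closure_of L \<noteq> {}"
    then obtain y where y: "y \<in> L'" "y \<in> X closure_of L" by blast
    obtain x where x: "x \<in> topspace X" "L = orbit G \<phi> x" using L by (auto simp: orbits_def)
    have yX: "y \<in> topspace X" using y(2) in_closure_of by fastforce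
    obtain x' where x': "x' \<in> topspace X" "L' = orbit G \<phi> x'" using L' by (auto simp: orbits_def)
    show "L' \<subseteq> X closure_of L"
    proof
      fix w assume "w \<in> L'"
      then have "w \<in> topspace X"
        using L' orbits_coverture by blast
      then have "w \<in> orbit G \<phi> y"
        using \<open>w \<in> L'\<close> y(1) x' orbit_trans[OF yX x'(1)] orbit_sym[OF x'(1) yX] by blast
      then obtain g where g: "g \<in> carrier G" "w = \<phi> g y" by (auto simp: orbit_def)
      have "continuous_map X X ((\<lambda>(g, x). \<phi> g x) \<circ> (\<lambda>x. (g, x)))"
        using g(1) T by (intro continuous_map_compose[OF _ cont]) (simp add: continuous_map_pairedI)
      then have "continuous_map X X (\<phi> g)" by (simp add: o_def)
      then have "w \<in> X closure_of (\<phi> g ` L)"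
        using continuous_map_image_closure_subset y(2) g(2) by blast
      moreover have "\<phi> g ` L \<subseteq> L"
      proof clarify
        fix v assume v: "v \<in> L"
        then have vX: "v \<in> topspace X" using L orbits_coverture by blast
        then have "\<phi> g v \<in> topspace X" using element_image g(1) by blast
        moreover have "\<phi> g v \<in> orbit G \<phi> v" using g(1) unfolding orbit_def by blast
        ultimately show "\<phi> g v \<in> L" using orbit_trans[OF x(1) vX] v x(2) by blast
      qed
      ultimately show "w \<in> X closure_of L" using closure_of_mono by blast
    qed
  qed
qed


section \<open>Leaves of foliated spaces\<close>

text \<open>A ball is the union of the radial segments from its centre. The segments are written out in
  coordinates because the space \<open>nat \<Rightarrow> real\<close> is handled as an abstract topology here, not as a
  normed space.\<close>

lemma connectedin_euclidean_ball:
  assumes "euclidean_ball n B"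
  shows "connectedin (Euclidean_space n) B"
proof -
  obtain c \<rho> where c: "c \<in> topspace (Euclidean_space n)" "\<rho> > 0"
    and B: "B = {x \<in> topspace (Euclidean_space n). sqrt (\<Sum>i<n. (x i - c i)\<^sup>2) < \<rho>}"
    using assms by (auto simp: euclidean_ball_def)
  have seg: "\<exists>S. connectedin (Euclidean_space n) S \<and> c \<in> S \<and> x \<in> S \<and> S \<subseteq> B" if x: "x \<in> B" for x
  proof -
    define f where "f = (\<lambda>t i. c i + t * (x i - c i))"
    have xs: "x \<in> topspace (Euclidean_space n)" and xB: "sqrt (\<Sum>i<n. (x i - c i)\<^sup>2) < \<rho>"
      using x B by auto
    have "continuous_map euclideanreal (powertop_real UNIV) f"
      unfolding f_def continuous_map_componentwise_UNIV
      by (auto intro!: continuous_intros)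
    then have f: "continuous_map euclideanreal (Euclidean_space n) f"
      using c(1) xs
      by (auto simp: Euclidean_space_def continuous_map_in_subtopology f_def)
    then have "connectedin (Euclidean_space n) (f ` {0..1})"
      by (rule connectedin_continuous_map_image) auto
    moreover have "c \<in> f ` {0..1}" "x \<in> f ` {0..1}"
      using image_eqI[of c f 0 "{0..1}"] image_eqI[of x f 1 "{0..1}"] by (auto simp: f_def)
    moreover have "f ` {0..1} \<subseteq> B"
    proof clarify
      fix t :: real assume t: "t \<in> {0..1}"
      have "(\<Sum>i<n. (f t i - c i)\<^sup>2) = t\<^sup>2 * (\<Sum>i<n. (x i - c i)\<^sup>2)"
        by (simp add: f_def power_mult_distrib sum_distrib_left)
      also have "\<dots> \<le> 1 * (\<Sum>i<n. (x i - c i)\<^sup>2)"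
        using t by (intro mult_right_mono) (auto simp: power_le_one sum_nonneg)
      finally have "sqrt (\<Sum>i<n. (f t i - c i)\<^sup>2) \<le> sqrt (\<Sum>i<n. (x i - c i)\<^sup>2)"
        by simp
      then have "sqrt (\<Sum>i<n. (f t i - c i)\<^sup>2) < \<rho>" using xB by linarith
      moreover have "f t \<in> topspace (Euclidean_space n)"
        using f by (auto simp: continuous_map_def)
      ultimately show "f t \<in> B" using B by blast
    qed
    ultimately show ?thesis by blast
  qed
  define \<S> where "\<S> = {S. connectedin (Euclidean_space n) S \<and> c \<in> S \<and> S \<subseteq> B}"
  have "B = \<Union>\<S>"
    using seg by (auto simp: \<S>_def)
  moreover have "connectedin (Euclidean_space n) (\<Union>\<S>)"
    by (cases "\<S> = {}", simp, rule connectedin_Union) (auto simp: \<S>_def)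
  ultimately show ?thesis by simp
qed

lemma foliated_chart_preimage_open:
  assumes "foliated_chart n X (U, \<phi>, B, Z)"
    and "openin (prod_topology (Euclidean_space n) Z) V"
  shows "openin X {x \<in> U. \<phi> x \<in> V}"
proof -
  have U: "openin X U" and hom: "homeomorphic_map (subtopology X U)
      (prod_topology (subtopology (Euclidean_space n) B) Z) \<phi>"
    using assms(1) by (auto simp: foliated_chart_def)
  have "continuous_map (subtopology X U) (prod_topology (subtopology (Euclidean_space n) B) Z) \<phi>"
    using hom by (rule homeomorphic_imp_continuous_map)
  then have "continuous_map (subtopology X U)
      (subtopology (prod_topology (Euclidean_space n) Z) (B \<times> topspace Z)) \<phi>"
    by (simp add: prod_topology_subtopology(1))
  then have "continuous_map (subtopology X U) (prod_topology (Euclidean_space n) Z) \<phi>"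
    by (rule continuous_map_into_fulltopology)
  then have "openin (subtopology X U) {x \<in> topspace (subtopology X U). \<phi> x \<in> V}"
    using assms(2) openin_continuous_map_preimage by blast
  moreover have "topspace (subtopology X U) = U"
    using openin_subset[OF U] by (simp add: Int_absorb1)
  ultimately show ?thesis using U openin_trans_full by fastforce
qed

lemma foliated_chartD:
  assumes "foliated_chart n X (U, \<phi>, B, Z)"
  shows "openin X U" "U \<subseteq> topspace X" "inj_on \<phi> U" "\<phi> ` U = B \<times> topspace Z"
    "B \<subseteq> topspace (Euclidean_space n)"
    "homeomorphic_map (subtopology X U) (prod_topology (subtopology (Euclidean_space n) B) Z) \<phi>"
proof -
  show U: "openin X U" and hom: "homeomorphic_map (subtopology X U)
      (prod_topology (subtopology (Euclidean_space n) B) Z) \<phi>"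
    using assms by (auto simp: foliated_chart_def)
  show UX: "U \<subseteq> topspace X" using openin_subset[OF U] .
  show B: "B \<subseteq> topspace (Euclidean_space n)"
    using assms by (auto simp: foliated_chart_def euclidean_ball_def)
  have top: "topspace (subtopology X U) = U"
    using UX by (simp add: Int_absorb1)
  show "inj_on \<phi> U" using homeomorphic_imp_injective_map[OF hom] top by simp
  show "\<phi> ` U = B \<times> topspace Z"
    using homeomorphic_imp_surjective_map[OF hom] top B by (simp add: Int_absorb1)
qed

context
  fixes r :: enat and n :: nat and X :: "'a topology" and A :: "('a, 'z) foliated_chart set"
  assumes atlas: "foliated_atlas r n X A"
begin

lemma atlas_chart: "(U, \<phi>, B, Z) \<in> A \<Longrightarrow> foliated_chart n X (U, \<phi>, B, Z)"
  using atlas by (simp add: foliated_atlas_def)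

lemma atlas_cover:
  assumes "x \<in> topspace X"
  obtains U \<phi> B Z where "(U, \<phi>, B, Z) \<in> A" "x \<in> U"
  using assms atlas unfolding foliated_atlas_def by blast

lemma plaque_subset: "P \<in> plaques A \<Longrightarrow> P \<subseteq> topspace X"
  using foliated_chartD(2)[OF atlas_chart] by (fastforce simp: plaques_def)

lemma plaque_through:
  assumes c: "(U, \<phi>, B, Z) \<in> A" and x: "x \<in> U"
  shows "{y \<in> U. \<phi> y \<in> B \<times> {snd (\<phi> x)}} \<in> plaques A"
    "x \<in> {y \<in> U. \<phi> y \<in> B \<times> {snd (\<phi> x)}}"
proof -
  have "\<phi> x \<in> B \<times> topspace Z" using foliated_chartD(4)[OF atlas_chart[OF c]] x by blast
  then have "snd (\<phi> x) \<in> topspace Z" "\<phi> x \<in> B \<times> {snd (\<phi> x)}" by (auto simp: mem_Times_iff)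
  then show "{y \<in> U. \<phi> y \<in> B \<times> {snd (\<phi> x)}} \<in> plaques A"
    "x \<in> {y \<in> U. \<phi> y \<in> B \<times> {snd (\<phi> x)}}"
    using c x unfolding plaques_def by blast+
qed

lemma openin_plaque_self: "P \<in> plaques A \<Longrightarrow> openin (subtopology X P) P"
  by (simp add: openin_subtopology_refl plaque_subset)

text \<open>The second component \<open>h2\<close> of a coordinate change depends on the transverse coordinate only.
  Near a common point, the plaque \<open>P\<close> is therefore mapped into a single level of the other chart,
  that is into \<open>P'\<close>. Consequently the leaf topology induces on a plaque nothing finer than the
  topology of \<open>X\<close>.\<close>

lemma openin_plaque_Int_plaque:
  assumes P: "P \<in> plaques A" and P': "P' \<in> plaques A"
  shows "openin (subtopology X P) (P \<inter> P')"
proof (subst openin_subopen, intro ballI)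
  fix p assume p: "p \<in> P \<inter> P'"
  obtain U \<phi> B Z z where c: "(U, \<phi>, B, Z) \<in> A" and P_eq: "P = {x \<in> U. \<phi> x \<in> B \<times> {z}}"
    using P unfolding plaques_def by blast
  obtain U' \<phi>' B' Z' z' where c': "(U', \<phi>', B', Z') \<in> A" and P'_eq: "P' = {x \<in> U'. \<phi>' x \<in> B' \<times> {z'}}"
    using P' unfolding plaques_def by blast
  note facts = foliated_chartD[OF atlas_chart[OF c]]
  note facts' = foliated_chartD[OF atlas_chart[OF c']]
  have pU: "p \<in> U" "p \<in> U'" using p P_eq P'_eq by auto
  have "locally_Cr_foliated_map_on r n Z Z' (\<phi> ` (U \<inter> U')) (\<phi>' \<circ> inv_into U \<phi>)"
    using atlas c c' unfolding foliated_atlas_def by fast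
  then obtain V where V: "openin (prod_topology (Euclidean_space n) Z) V" "\<phi> p \<in> V"
      "V \<subseteq> \<phi> ` (U \<inter> U')" and h: "Cr_foliated_map_on r n Z Z' V (\<phi>' \<circ> inv_into U \<phi>)"
    unfolding locally_Cr_foliated_map_on_def using pU by blast
  obtain h1 h2 where h12: "\<And>x z. (x, z) \<in> V \<Longrightarrow> (\<phi>' \<circ> inv_into U \<phi>) (x, z) = (h1 (x, z), h2 z)"
    using h unfolding Cr_foliated_map_on_def by blast
  have snd_\<phi>': "x \<in> U' \<and> snd (\<phi>' x) = h2 (snd (\<phi> x))" if x: "x \<in> U" "\<phi> x \<in> V" for x
  proof -
    have "x \<in> U'" using x V(3) facts(3) by (auto simp: inj_on_def)
    moreover have "\<phi>' x = (h1 (\<phi> x), h2 (snd (\<phi> x)))"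
      using h12[of "fst (\<phi> x)" "snd (\<phi> x)"] x facts(3) by simp
    ultimately show ?thesis by simp
  qed
  let ?T = "P \<inter> {x \<in> U. \<phi> x \<in> V}"
  have "openin (subtopology X P) ?T"
    using foliated_chart_preimage_open[OF atlas_chart[OF c] V(1)] by (simp add: openin_subtopology_Int2)
  moreover have "p \<in> ?T" using p pU V by simp
  moreover have "?T \<subseteq> P \<inter> P'"
  proof
    fix x assume x: "x \<in> ?T"
    have "snd (\<phi> x) = snd (\<phi> p)" using x p P_eq by auto
    then have "snd (\<phi>' x) = z'"
      using snd_\<phi>'[of x] snd_\<phi>'[of p] x pU V(2) p P'_eq by (auto simp: mem_Times_iff)
    moreover have "x \<in> U'" using snd_\<phi>' x by blast
    moreover have "\<phi>' x \<in> B' \<times> topspace Z'" using \<open>x \<in> U'\<close> facts'(4) by blast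
    ultimately show "x \<in> P \<inter> P'" using x P'_eq by (auto simp: mem_Times_iff)
  qed
  ultimately show "\<exists>T. openin (subtopology X P) T \<and> p \<in> T \<and> T \<subseteq> P \<inter> P'" by blast
qed

lemma topspace_leaf_topology: "topspace (leaf_topology X A) = topspace X"
proof
  show "topspace (leaf_topology X A) \<subseteq> topspace X"
    unfolding leaf_topology_def using openin_subset by (fastforce simp: topology_generated_by_topspace)
  show "topspace X \<subseteq> topspace (leaf_topology X A)"
  proof
    fix x assume "x \<in> topspace X"
    then obtain U \<phi> B Z where "(U, \<phi>, B, Z) \<in> A" "x \<in> U" by (rule atlas_cover)
    note c = this
    obtain P where P: "P \<in> plaques A" "x \<in> P"
      by (rule that[OF plaque_through[OF c]])
    then have "openin (subtopology X P) P" using openin_plaque_self by simp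
    then show "x \<in> topspace (leaf_topology X A)"
      unfolding leaf_topology_def topology_generated_by_topspace using P by blast
  qed
qed

lemma openin_leaf_topology_plaque:
  "P \<in> plaques A \<Longrightarrow> openin (leaf_topology X A) P"
  unfolding leaf_topology_def
  by (rule topology_generated_by_Basis) (use openin_plaque_self in blast)

text \<open>The leaf topology is finer than the topology of \<open>X\<close>; hence sets closed in \<open>X\<close> are closed in
  the leaf topology.\<close>

lemma openin_leaf_topology:
  assumes W: "openin X W"
  shows "openin (leaf_topology X A) W"
proof -
  have "openin (leaf_topology X A) (P \<inter> W)" if "P \<in> plaques A" for P
    unfolding leaf_topology_def using that W
    by (intro topology_generated_by_Basis) (use openin_subtopology_Int2 in blast)
  then have "openin (leaf_topology X A) (\<Union>P \<in> plaques A. P \<inter> W)" by blast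
  moreover have "(\<Union>P \<in> plaques A. P \<inter> W) = W"
  proof
    show "W \<subseteq> (\<Union>P \<in> plaques A. P \<inter> W)"
    proof
      fix x assume x: "x \<in> W"
      then have "x \<in> topspace X" using openin_subset[OF W] by blast
      then obtain U \<phi> B Z where "(U, \<phi>, B, Z) \<in> A" "x \<in> U" by (rule atlas_cover)
      note c = this
      show "x \<in> (\<Union>P \<in> plaques A. P \<inter> W)"
        using plaque_through[OF c] x by (intro UN_I IntI)
    qed
  qed auto
  ultimately show ?thesis by simp
qed

text \<open>A plaque is a copy of a ball, hence connected in \<open>X\<close>. The inclusion of the plaque into the leaf
  topology is continuous, since the generating sets meet it in relatively open sets by
  \<open>openin_plaque_Int_plaque\<close>, so that connectedness carries over.\<close>

lemma connectedin_leaf_topology_plaque: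
  assumes P: "P \<in> plaques A"
  shows "connectedin (leaf_topology X A) P"
proof -
  obtain U \<phi> B Z z where c: "(U, \<phi>, B, Z) \<in> A" and z: "z \<in> topspace Z"
    and P_eq: "P = {x \<in> U. \<phi> x \<in> B \<times> {z}}"
    using P unfolding plaques_def by blast
  note facts = foliated_chartD[OF atlas_chart[OF c]]
  have ball: "euclidean_ball n B" using atlas_chart[OF c] by (simp add: foliated_chart_def)
  have "\<phi> ` P = B \<times> {z}"
  proof
    show "B \<times> {z} \<subseteq> \<phi> ` P"
    proof
      fix w assume w: "w \<in> B \<times> {z}"
      then have "w \<in> \<phi> ` U" using facts(4) z by auto
      then obtain u where "u \<in> U" "w = \<phi> u" by blast
      with w show "w \<in> \<phi> ` P" unfolding P_eq by (intro image_eqI[of _ _ u]) simp_all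
    qed
  qed (auto simp: P_eq)
  moreover have "connectedin (prod_topology (subtopology (Euclidean_space n) B) Z) (B \<times> {z})"
    using connectedin_euclidean_ball[OF ball] z by (simp add: connectedin_Times connectedin_subtopology)
  ultimately have "connectedin (subtopology X U) P"
    using homeomorphic_map_connectedness_eq[OF facts(6)] facts(2) P_eq by auto
  then have "connectedin (subtopology X P) P" by (simp add: connectedin_subtopology)
  moreover have "continuous_map (subtopology X P) (leaf_topology X A) id"
    unfolding leaf_topology_def
  proof (rule continuous_on_generated_topo)
    fix V assume "V \<in> {V. \<exists>P \<in> plaques A. openin (subtopology X P) V}"
    then obtain P' W where P': "P' \<in> plaques A" "openin X W" "V = W \<inter> P'"
      by (auto simp: openin_subtopology)
    have "openin (subtopology X P) ((P \<inter> W) \<inter> (P \<inter> P'))"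
      by (rule openin_Int[OF openin_subtopology_Int2[OF P'(2)]
          openin_plaque_Int_plaque[OF P P'(1)]])
    moreover have "id -` V \<inter> topspace (subtopology X P) = (P \<inter> W) \<inter> (P \<inter> P')"
      using P'(3) plaque_subset[OF P] by auto
    ultimately show "openin (subtopology X P) (id -` V \<inter> topspace (subtopology X P))" by simp
  next
    show "id ` topspace (subtopology X P) \<subseteq> \<Union>{V. \<exists>P \<in> plaques A. openin (subtopology X P) V}"
      using topspace_leaf_topology unfolding leaf_topology_def topology_generated_by_topspace by auto
  qed
  ultimately show ?thesis using connectedin_continuous_map_image by fastforce
qed

text \<open>If \<open>y\<close> is in the closure of \<open>L\<close>, so is every point \<open>y'\<close> of the plaque \<open>P\<close> of \<open>y\<close>: a neighbourhood
  of \<open>y'\<close> contains a product box in the chart, and \<open>L\<close> comes so close to \<open>y\<close> that it has a point \<open>p\<close>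
  whose transverse coordinate lies in that box. The plaque through \<open>p\<close> is connected, so it is part
  of \<open>L\<close>, and it crosses the box.\<close>

lemma openin_leaf_topology_closure_of_leaf:
  assumes L: "L \<in> leaves X A"
  shows "openin (leaf_topology X A) (X closure_of L)"
proof (subst openin_subopen, intro ballI)
  fix y assume y: "y \<in> X closure_of L"
  then have "y \<in> topspace X" using in_closure_of by fastforce
  then obtain U \<phi> B Z where c: "(U, \<phi>, B, Z) \<in> A" and yU: "y \<in> U" by (rule atlas_cover)
  note facts = foliated_chartD[OF atlas_chart[OF c]]
  define P where "P = {x \<in> U. \<phi> x \<in> B \<times> {snd (\<phi> y)}}"
  note P = plaque_through[OF c yU, folded P_def]
  have "P \<subseteq> X closure_of L"
  proof
    fix y' assume y': "y' \<in> P"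
    then have y'U: "y' \<in> U" "fst (\<phi> y') \<in> B" "snd (\<phi> y') = snd (\<phi> y)"
      by (auto simp: P_def mem_Times_iff)
    show "y' \<in> X closure_of L"
      unfolding in_closure_of
    proof (intro conjI allI impI)
      show "y' \<in> topspace X" using y'U facts(2) by blast
      fix W assume W: "y' \<in> W \<and> openin X W"
      have "openin (subtopology X U) (U \<inter> W)" using W by (simp add: openin_subtopology_Int2)
      then have "openin (prod_topology (subtopology (Euclidean_space n) B) Z) (\<phi> ` (U \<inter> W))"
        using homeomorphic_imp_open_map[OF facts(6)] by (simp add: open_map_def)
      moreover have "(fst (\<phi> y'), snd (\<phi> y')) \<in> \<phi> ` (U \<inter> W)"
          using W y'U(1) unfolding prod.collapse by blast
      ultimately have "\<exists>B1 Z1. openin (subtopology (Euclidean_space n) B) B1 \<and> openin Z Z1 \<and>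
          fst (\<phi> y') \<in> B1 \<and> snd (\<phi> y') \<in> Z1 \<and> B1 \<times> Z1 \<subseteq> \<phi> ` (U \<inter> W)"
        unfolding openin_prod_topology_alt by metis
      then obtain B1 Z1 where Z1: "openin Z Z1" and b: "fst (\<phi> y') \<in> B1" "snd (\<phi> y') \<in> Z1"
        and sub: "B1 \<times> Z1 \<subseteq> \<phi> ` (U \<inter> W)" by blast
      \<comment> \<open>The tube of all plaques with transverse coordinate in \<open>Z1\<close> is a neighbourhood of \<open>y\<close>.\<close>
      have "openin (prod_topology (Euclidean_space n) Z) (topspace (Euclidean_space n) \<times> Z1)"
        using Z1 by (simp add: openin_prod_Times_iff)
      then have "openin X {x \<in> U. \<phi> x \<in> topspace (Euclidean_space n) \<times> Z1}"
        by (rule foliated_chart_preimage_open[OF atlas_chart[OF c]])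
      moreover have "\<phi> y \<in> topspace (Euclidean_space n) \<times> Z1"
      proof -
        have "\<phi> y \<in> B \<times> topspace Z" using facts(4) yU by blast
        then show ?thesis using facts(5) b(2) y'U(3) by (auto simp: mem_Times_iff)
      qed
      ultimately have "\<exists>p. p \<in> L \<and> p \<in> {x \<in> U. \<phi> x \<in> topspace (Euclidean_space n) \<times> Z1}"
        using y yU unfolding in_closure_of[of y] by (metis (mono_tags, lifting) mem_Collect_eq)
      then obtain p where p: "p \<in> L" "p \<in> U" "snd (\<phi> p) \<in> Z1"
        by (auto simp: mem_Times_iff)
      define P' where "P' = {x \<in> U. \<phi> x \<in> B \<times> {snd (\<phi> p)}}"
      note P' = plaque_through[OF c p(2), folded P'_def]
      have "P' \<subseteq> L"
        using connected_components_of_maximal[OF L[unfolded leaves_def]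
            connectedin_leaf_topology_plaque[OF P'(1)]] p(1) P'(2)
        by (auto simp: disjnt_iff)
      \<comment> \<open>The point of the plaque of \<open>p\<close> on the same height as \<open>y'\<close> lies in the box.\<close>
      moreover have "(fst (\<phi> y'), snd (\<phi> p)) \<in> \<phi> ` (U \<inter> W)"
        by (rule subsetD[OF sub]) (simp add: b(1) p(3))
      then obtain w where w: "w \<in> U \<inter> W" "\<phi> w = (fst (\<phi> y'), snd (\<phi> p))"
        by (metis imageE)
      moreover from w y'U(2) have "w \<in> P'" by (simp add: P'_def)
      ultimately show "\<exists>w. w \<in> L \<and> w \<in> W" by blast
    qed
  qed
  then show "\<exists>T. openin (leaf_topology X A) T \<and> y \<in> T \<and> T \<subseteq> X closure_of L"
    using openin_leaf_topology_plaque[OF P(1)] P(2) by blast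
qed

lemma saturated_closures_leaves: "saturated_closures X (leaves X A)"
proof
  show "partition_on (topspace X) (leaves X A)"
    unfolding leaves_def
  proof (rule partition_onI)
    show "\<Union>(connected_components_of (leaf_topology X A)) = topspace X"
      by (simp add: Union_connected_components_of topspace_leaf_topology)
    show "{} \<notin> connected_components_of (leaf_topology X A)"
      using nonempty_connected_components_of by blast
  qed (metis pairwise_disjoint_connected_components_of pairwiseD)
next
  fix L L' assume L: "L \<in> leaves X A" and L': "L' \<in> leaves X A"
    and meet: "L' \<inter> X closure_of L \<noteq> {}"
  \<comment> \<open>A component of the leaf topology that meets a clopen set lies inside it.\<close>
  have "openin (leaf_topology X A) (topspace X - X closure_of L)"
    by (intro openin_leaf_topology openin_diff openin_topspace closedin_closure_of)
  then have "closedin (leaf_topology X A) (X closure_of L)"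
    by (simp add: closedin_def topspace_leaf_topology closure_of_subset_topspace)
  moreover have "connectedin (leaf_topology X A) L'"
    using L' by (simp add: leaves_def connectedin_connected_components_of)
  ultimately show "L' \<subseteq> X closure_of L"
    using connectedin_clopen_cases openin_leaf_topology_closure_of_leaf[OF L] meet
    by (metis disjnt_def)
qed

end


section \<open>The Morse hyper-graph of a foliation or a group action\<close>

theorem theorem7p12:
  fixes X :: "'a topology" and F :: "'a set set"
    and r :: enat and n :: nat and A :: "('a, 'z) foliated_chart set"
    and G :: "('g, 'm) monoid_scheme" and T :: "'g topology" and \<phi> :: "'g \<Rightarrow> 'a \<Rightarrow> 'a"
  assumes "(compact_space X \<and> foliated_space r n X A \<and> F = leaves X A) \<or>
           (continuous_group_action G T X \<phi> \<and> F = orbits G (topspace X) \<phi>)"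
  shows "morse_hyper_graph_exists X F \<and>
    partition_on (topspace X) (morse_members X F) \<and>
    (\<forall>x \<in> topspace X. \<exists>!D. D \<in> morse_members X F \<and> abstract_element_at X F x \<subseteq> D) \<and>
    (\<forall>x \<in> topspace X. \<exists>!D. D \<in> morse_members X F \<and> abstract_weak_element_at X F x \<subseteq> D) \<and>
    (\<exists>p. quotient_map (abstract_element_space X F) (morse_hyper_graph_space X F) p \<and>
      (\<forall>x \<in> topspace X. p (abstract_element_at X F x) = element_of (morse_members X F) x)) \<and>
    (\<exists>p. quotient_map (abstract_weak_element_space X F) (morse_hyper_graph_space X F) p \<and>
      (\<forall>x \<in> topspace X. p (abstract_weak_element_at X F x) = element_of (morse_members X F) x))"
proof -
  have "saturated_closures X F"
    using assms
  proof (elim disjE conjE)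
    assume "foliated_space r n X A" "F = leaves X A"
    then show ?thesis using saturated_closures_leaves[of r n X A] by (simp add: foliated_space_def)
  next
    assume "continuous_group_action G T X \<phi>" "F = orbits G (topspace X) \<phi>"
    then show ?thesis using saturated_closures_orbits[of G T X \<phi>] by simp
  qed
  then show ?thesis by (rule saturated_closures.morse_hyper_graph_quotient)
qed

end
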